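(* Let $\Omega\subset X$ be a $\nu$-measurable set with $0<\nu(\Omega)<\nu(X)$. Then: (i) If $\left(\lambda_\Omega^m,\frac1{\nu(\Omega)}\chi_\Omega\right)$ is an $m$-eigenpair of $\Delta_1^m$, then $\Omega$ is $m$-calibrable. (ii) If $\Omega$ is $m$-calibrable and $$m_x(\Omega)\le\lambda_\Omega^m\quad\text{for } \nu\text{-almost every } x\in X\setminus\Omega,$$ then $\left(\lambda_\Omega^m,\frac1{\nu(\Omega)}\chi_\Omega\right)$ is an $m$-eigenpair of $\Delta_1^m$.
   Context: Metric random walk space: $(X,d)$ is a Polish metric space with its Borel $\sigma$-algebra and $m=(m_x)_{x\in X}$ is a family of Borel probability measures on $X$ such that $x\mapsto m_x(A)$ is Borel for every Borel set $A$, and each $m_x$ has finite first moment ($\int_X d(z,y)\,dm_x(y)<\infty$ for some, hence every, $z\in X$). $\nu$ is a $\sigma$-finite Radon measure on $X$ that is invariant, $\nu(A)=\int_X m_x(A)\,d\nu(x)$, and reversible for $m$: for every Borel $C\subset X\times X$, $\int_X\int_X\chi_C(x,y)\,dm_x(y)d\nu(x)=\int_X\int_X\chi_C(x,y)\,dm_y(x)d\nu(y)$. Put $L_m(A,B)=\int_A\int_B dm_x(y)d\nu(x)$; the space is assumed $m$-connected: $L_m(A,B)>0$ for any $\nu$-measurable sets $A,B$ of positive $\nu$-measure with $A\cup B=X$. $P_m(E)=L_m(E,X\setminus E)=\int_E\int_{X\setminus E}dm_x(y)d\nu(x)$ and $\lambda_\Omega^m:=\frac{P_m(\Omega)}{\nu(\Omega)}$.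 $\Omega$ is $m$-calibrable if $\lambda_\Omega^m=\inf\left\{\frac{P_m(E)}{\nu(E)}: E\subset\Omega \ \nu\text{-measurable},\ \nu(E)>0\right\}$. For $\nu$-measurable $u$, $TV_m(u)=\frac12\int_X\int_X|u(y)-u(x)|\,dm_x(y)d\nu(x)\in[0,\infty]$; $\mathcal F_m:L^2(X,\nu)\to[0,+\infty]$, $\mathcal F_m(u)=TV_m(u)$. $w\in\partial\mathcal F_m(u)$ iff $\mathcal F_m(u)<\infty$ and $\mathcal F_m(z)\ge\mathcal F_m(u)+\int_X w(z-u)\,d\nu$ for all $z\in L^2(X,\nu)$; $v\in\Delta_1^m u$ iff $-v\in\partial\mathcal F_m(u)$. Multivalued sign: $\mathrm{sign}(r)=1$ if $r>0$, $[-1,1]$ if $r=0$, $-1$ if $r<0$. A pair $(\lambda,u)\in\mathbb R\times L^2(X,\nu)$ is an $m$-eigenpair of $\Delta_1^m$ if $\|u\|_{L^1(X,\nu)}=1$ and there is a function $\xi$ with $\xi(x)\in\mathrm{sign}(u(x))$ such that $\lambda\xi\in\partial\mathcal F_m(u)=-\Delta_1^m u$. *)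

theory Defs
  imports "HOL-Probability.Probability"
begin

text \<open>
  Measurability with respect to \<open>\<nu>\<close> is measurability with respect to the completion of \<open>\<nu>\<close>.
  If \<open>B\<close> is \<open>\<nu>\<close>-measurable, then, by invariance of \<open>\<nu>\<close>, it belongs to the completion of
  \<open>m x\<close> for \<open>\<nu>\<close>-almost every \<open>x\<close>; hence the inner integrals below are taken with respect to
  the completion of \<open>m x\<close>, and the outer ones are unaffected by the exceptional points.
\<close>

definition radon_measure :: "'a::topological_space measure \<Rightarrow> bool" where
  "radon_measure \<nu> \<longleftrightarrow>
     sets \<nu> = sets borel \<and>
     (\<forall>x. \<exists>U. open U \<and> x \<in> U \<and> emeasure \<nu> U < \<infinity>) \<and>
     (\<forall>A\<in>sets \<nu>. emeasure \<nu> A = (SUP K\<in>{K. compact K \<and> K \<subseteq> A}. emeasure \<nu> K))"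

definition L_m :: "('a \<Rightarrow> 'a measure) \<Rightarrow> 'a measure \<Rightarrow> 'a set \<Rightarrow> 'a set \<Rightarrow> ennreal" where
  "L_m m \<nu> A B = (\<integral>\<^sup>+x\<in>A. emeasure (completion (m x)) B \<partial>completion \<nu>)"

locale metric_random_walk =
  fixes m :: "'a::polish_space \<Rightarrow> 'a measure"
  assumes prob_space_m: "\<And>x. prob_space (m x)"
    and sets_m: "\<And>x. sets (m x) = sets borel"
    and kernel_measurable:
      "\<And>A. A \<in> sets borel \<Longrightarrow> (\<lambda>x. emeasure (m x) A) \<in> borel_measurable borel"
    and finite_first_moment: "\<And>x. \<exists>z. (\<integral>\<^sup>+y. ennreal (dist z y) \<partial>m x) < \<infinity>"

locale reversible_metric_random_walk = metric_random_walk m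
  for m :: "'a::polish_space \<Rightarrow> 'a measure" +
  fixes \<nu> :: "'a measure"
  assumes sigma_finite_nu: "sigma_finite_measure \<nu>"
    and radon_nu: "radon_measure \<nu>"
    and invariant:
      "\<And>A. A \<in> sets borel \<Longrightarrow> emeasure \<nu> A = (\<integral>\<^sup>+x. emeasure (m x) A \<partial>\<nu>)"
    and reversible:
      "\<And>C. C \<in> sets borel \<Longrightarrow>
         (\<integral>\<^sup>+x. (\<integral>\<^sup>+y. indicator C (x, y) \<partial>m x) \<partial>\<nu>) =
         (\<integral>\<^sup>+y. (\<integral>\<^sup>+x. indicator C (x, y) \<partial>m y) \<partial>\<nu>)"
    and m_connected:
      "\<And>A B. \<lbrakk>A \<in> sets (completion \<nu>); B \<in> sets (completion \<nu>);
         emeasure (completion \<nu>) A > 0; emeasure (completion \<nu>) B > 0; A \<union> B = UNIV\<rbrakk>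
         \<Longrightarrow> L_m m \<nu> A B > 0"

definition P_m :: "('a \<Rightarrow> 'a measure) \<Rightarrow> 'a measure \<Rightarrow> 'a set \<Rightarrow> ennreal" where
  "P_m m \<nu> E = L_m m \<nu> E (- E)"

definition lambda_m :: "('a \<Rightarrow> 'a measure) \<Rightarrow> 'a measure \<Rightarrow> 'a set \<Rightarrow> ennreal" where
  "lambda_m m \<nu> E = P_m m \<nu> E / emeasure (completion \<nu>) E"

definition m_calibrable :: "('a \<Rightarrow> 'a measure) \<Rightarrow> 'a measure \<Rightarrow> 'a set \<Rightarrow> bool" where
  "m_calibrable m \<nu> \<Omega> \<longleftrightarrow>
     lambda_m m \<nu> \<Omega> =
       (INF E\<in>{E. E \<subseteq> \<Omega> \<and> E \<in> sets (completion \<nu>) \<and> emeasure (completion \<nu>) E > 0}.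
          P_m m \<nu> E / emeasure (completion \<nu>) E)"

definition TV_m :: "('a \<Rightarrow> 'a measure) \<Rightarrow> 'a measure \<Rightarrow> ('a \<Rightarrow> real) \<Rightarrow> ennreal" where
  "TV_m m \<nu> u =
     (1 / 2) * (\<integral>\<^sup>+x. (\<integral>\<^sup>+y. ennreal \<bar>u y - u x\<bar> \<partial>completion (m x)) \<partial>completion \<nu>)"

text \<open>Elements of \<open>L\<^sup>2\<close> are represented by functions; no quotient is formed.\<close>

definition L2_fun :: "'a measure \<Rightarrow> ('a \<Rightarrow> real) set" where
  "L2_fun \<nu> = {u. u \<in> borel_measurable (completion \<nu>) \<and>
                   integrable (completion \<nu>) (\<lambda>x. (u x)\<^sup>2)}"

text \<open>The subdifferential of \<open>TV_m\<close> restricted to \<open>L\<^sup>2\<close>, where that functional is called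
  \<open>\<F>\<^sub>m\<close>.\<close>

definition subdiff_F :: "('a \<Rightarrow> 'a measure) \<Rightarrow> 'a measure \<Rightarrow> ('a \<Rightarrow> real) \<Rightarrow> ('a \<Rightarrow> real) set" where
  "subdiff_F m \<nu> u =
     {w. u \<in> L2_fun \<nu> \<and> w \<in> L2_fun \<nu> \<and> TV_m m \<nu> u < \<infinity> \<and>
         (\<forall>z\<in>L2_fun \<nu>. enn2ereal (TV_m m \<nu> z) \<ge>
            enn2ereal (TV_m m \<nu> u) + ereal (\<integral>x. w x * (z x - u x) \<partial>completion \<nu>))}"

definition Delta1_m :: "('a \<Rightarrow> 'a measure) \<Rightarrow> 'a measure \<Rightarrow> ('a \<Rightarrow> real) \<Rightarrow> ('a \<Rightarrow> real) set" where
  "Delta1_m m \<nu> u = {v. (\<lambda>x. - v x) \<in> subdiff_F m \<nu> u}"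

definition multi_sign :: "real \<Rightarrow> real set" where
  "multi_sign r = (if r > 0 then {1} else if r = 0 then {-1..1} else {-1})"

text \<open>The membership of \<open>\<lambda>\<xi>\<close> in the subdifferential at \<open>u\<close> is written as that of
  \<open>- \<lambda>\<xi>\<close> in \<open>Delta1_m m \<nu> u\<close>.\<close>

definition m_eigenpair ::
  "('a \<Rightarrow> 'a measure) \<Rightarrow> 'a measure \<Rightarrow> real \<Rightarrow> ('a \<Rightarrow> real) \<Rightarrow> bool" where
  "m_eigenpair m \<nu> l u \<longleftrightarrow>
     u \<in> L2_fun \<nu> \<and>
     (\<integral>\<^sup>+x. ennreal \<bar>u x\<bar> \<partial>completion \<nu>) = 1 \<and>
     (\<exists>\<xi>. (\<forall>x. \<xi> x \<in> multi_sign (u x)) \<and> (\<lambda>x. - (l * \<xi> x)) \<in> Delta1_m m \<nu> u)"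

end

theory Submission
  imports Defs
begin

text \<open>
  Call \<open>L(A, B)\<close> the flow from \<open>A\<close> to \<open>B\<close>; reversibility makes it symmetric.
  Write \<open>\<lambda> = P(\<Omega>) / \<nu>(\<Omega>)\<close>, \<open>u = \<chi>\<^sub>\<Omega> / \<nu>(\<Omega>)\<close> and \<open>q(x) = m\<^sub>x(\<Omega>)\<close>. The normalized indicator of a set \<open>E\<close>
  has total variation \<open>P(E) / \<nu>(E)\<close>.

  If \<open>(\<lambda>, u)\<close> is an eigenpair, then \<open>\<xi> = 1\<close> on \<open>\<Omega>\<close>, so the subgradient inequality tested with
  \<open>\<chi>\<^sub>E / \<nu>(E)\<close>, \<open>E \<subseteq> \<Omega>\<close>, has a vanishing linear term: \<open>\<lambda>\<xi>\<close> is constant on \<open>\<Omega>\<close>, and both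
  functions live on \<open>\<Omega>\<close> and have integral 1. What remains is \<open>P(E) / \<nu>(E) \<ge> \<lambda>\<close>.

  Conversely, let \<open>\<Omega>\<close> be calibrable. The subgradient used is \<open>\<lambda>\<close> on \<open>\<Omega>\<close> and \<open>- q\<close> outside; the
  hypothesis \<open>q \<le> \<lambda>\<close> outside \<open>\<Omega>\<close> says exactly that it has the form \<open>\<lambda>\<xi>\<close> with \<open>\<bar>\<xi>\<bar> \<le> 1\<close>. As
  \<open>\<integral> \<lambda>\<xi>u = \<lambda> = TV(u)\<close>, it is a subgradient as soon as
  \<open>TV(z) \<ge> \<integral> (\<lambda> \<chi>\<^sub>\<Omega> - q \<chi>\<^sub>-\<^sub>\<Omega>) z\<close> for every \<open>z\<close> in \<open>L\<^sup>2\<close>.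
  By the coarea formula (lemma \<open>TV_m_borel\<close>), \<open>TV(z)\<close> is the integral over all real levels \<open>t\<close>
  of \<open>P({z > t})\<close>, and the right-hand side is cut into levels in the same way. It therefore suffices
  to compare the two sides at each level. For \<open>t \<ge> 0\<close> and \<open>E = {z > t}\<close>, the comparison
  follows from the calibration inequality for \<open>E \<inter> \<Omega>\<close> (lemma \<open>calibrated_superlevel_inequality\<close>);
  for \<open>t < 0\<close> and \<open>F = {z \<le> t}\<close>, it follows from the calibration inequality for \<open>\<Omega> - F\<close>, subtracted
  from the equality \<open>P(\<Omega>) = \<lambda>\<nu>(\<Omega>)\<close> (lemma \<open>calibrated_sublevel_inequality\<close>).
  Integration over the levels is carried out in lemma \<open>calibrated_TV_m_inequality\<close>.

  All this takes place for Borel sets and functions. By invariance, a \<open>\<nu>\<close>-null set is \<open>m\<^sub>x\<close>-null for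
  almost every \<open>x\<close>, so that modifications on null sets change neither \<open>L\<close> nor \<open>TV\<close>.
\<close>

section \<open>Layer-cake decomposition and integrals of real functions\<close>

text \<open>
  Tonelli's theorem, applied to the length of the level interval \<open>[a x, b x)\<close>, which is the
  positive part of \<open>b x - a x\<close>. Taking \<open>0\<close> for \<open>a\<close> or for \<open>b\<close> yields the positive and the negative part
  of a function; taking two values of one function yields the coarea formula.
\<close>

lemma nn_integral_layer_cake:
  fixes a b :: "'a \<Rightarrow> real" and g :: "'a \<Rightarrow> ennreal"
  assumes "sigma_finite_measure M"
    and [measurable]: "a \<in> borel_measurable M" "b \<in> borel_measurable M" "g \<in> borel_measurable M"
  shows "(\<integral>\<^sup>+x. g x * ennreal (b x - a x) \<partial>M) =
    (\<integral>\<^sup>+t. (\<integral>\<^sup>+x. g x * indicator {a x..<b x} t \<partial>M) \<partial>lborel)"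
proof -
  interpret sigma_finite_measure M by fact
  interpret pair_sigma_finite M lborel ..
  have "(\<integral>\<^sup>+x. g x * ennreal (b x - a x) \<partial>M) =
      (\<integral>\<^sup>+x. (\<integral>\<^sup>+t. g x * indicator {a x..<b x} t \<partial>lborel) \<partial>M)"
  proof (intro nn_integral_cong)
    fix x
    have "emeasure lborel {a x..<b x} = ennreal (b x - a x)"
      by (cases "a x \<le> b x") (auto simp: ennreal_neg)
    then show "g x * ennreal (b x - a x) = (\<integral>\<^sup>+t. g x * indicator {a x..<b x} t \<partial>lborel)"
      by (simp add: nn_integral_cmult)
  qed
  also have "\<dots> = (\<integral>\<^sup>+t. (\<integral>\<^sup>+x. g x * indicator {a x..<b x} t \<partial>M) \<partial>lborel)"
    by (rule Fubini'[symmetric]) (simp add: indicator_def)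
  finally show ?thesis .
qed

text \<open>
  Turns a comparison of extended nonnegative integrals, with negative terms moved across, into one
  of Bochner integrals.
\<close>

lemma ereal_integral_le:
  fixes f :: "'a \<Rightarrow> real"
  assumes "integrable M f"
    and "(\<integral>\<^sup>+x. ennreal (f x) \<partial>M) \<le> T + (\<integral>\<^sup>+x. ennreal (- f x) \<partial>M)"
  shows "ereal (\<integral>x. f x \<partial>M) \<le> enn2ereal T"
proof (cases T)
  case (real r)
  have fin: "(\<integral>\<^sup>+x. ennreal (f x) \<partial>M) \<noteq> \<infinity>" "(\<integral>\<^sup>+x. ennreal (- f x) \<partial>M) \<noteq> \<infinity>"
    using assms(1) by (simp_all add: real_integrable_def)
  show ?thesis
    using assms(2) fin real
    by (cases rule: ennreal2_cases[of "\<integral>\<^sup>+x. ennreal (f x) \<partial>M" "\<integral>\<^sup>+x. ennreal (- f x) \<partial>M"])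
      (simp_all add: real_lebesgue_integral_def[OF assms(1)] ennreal_plus[symmetric] del: ennreal_plus)
qed simp

lemma integrable_mult_L2_fun:
  assumes "u \<in> L2_fun \<nu>" "v \<in> L2_fun \<nu>"
  shows "integrable (completion \<nu>) (\<lambda>x. u x * v x)"
proof (rule Bochner_Integration.integrable_bound)
  show "integrable (completion \<nu>) (\<lambda>x. (u x)\<^sup>2 + (v x)\<^sup>2)"
    using assms by (simp add: L2_fun_def)
  have "\<bar>a * b\<bar> \<le> a\<^sup>2 + b\<^sup>2" for a b :: real
  proof -
    have "0 \<le> (\<bar>a\<bar> - \<bar>b\<bar>)\<^sup>2" "0 \<le> \<bar>a\<bar> * \<bar>b\<bar>" by simp_all
    then have "2 * (\<bar>a\<bar> * \<bar>b\<bar>) \<le> a\<^sup>2 + b\<^sup>2" "0 \<le> \<bar>a\<bar> * \<bar>b\<bar>"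
      by (simp_all add: power2_diff mult.assoc)
    then show ?thesis unfolding abs_mult by linarith
  qed
  then show "AE x in completion \<nu>. norm (u x * v x) \<le> norm ((u x)\<^sup>2 + (v x)\<^sup>2)"
    by simp
  show "(\<lambda>x. u x * v x) \<in> borel_measurable (completion \<nu>)"
    using assms by (auto simp: L2_fun_def)
qed

lemma scaled_indicator_L2_fun:
  assumes "E \<in> sets (completion \<nu>)" "emeasure (completion \<nu>) E < \<infinity>"
  shows "(\<lambda>x. c * indicator E x) \<in> L2_fun \<nu>"
proof -
  have "(\<lambda>x. (c * indicator E x)\<^sup>2) = (\<lambda>x. c\<^sup>2 * indicator E x :: real)"
    by (auto simp: power_mult_distrib fun_eq_iff split: split_indicator)
  then show ?thesis
    using assms by (simp add: L2_fun_def borel_measurable_indicator)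
qed

context reversible_metric_random_walk
begin

section \<open>The symmetric flow between Borel sets\<close>

lemma sets_nu [measurable_cong, simp]: "sets \<nu> = sets borel"
  using radon_nu by (simp add: radon_measure_def)

lemmas [measurable_cong, simp] = sets_m

lemma space_nu [simp]: "space \<nu> = UNIV"
  using sets_eq_imp_space_eq[OF sets_nu] by simp

lemma space_m [simp]: "space (m x) = UNIV"
  using sets_eq_imp_space_eq[OF sets_m] by simp

lemma measurable_m [measurable]: "m \<in> measurable borel (subprob_algebra borel)"
  by (rule measurable_subprob_algebra)
    (auto intro: kernel_measurable prob_space_imp_subprob_space prob_space_m)

lemma L_m_borel:
  assumes [measurable]: "A \<in> sets borel" "B \<in> sets borel"
  shows "L_m m \<nu> A B = (\<integral>\<^sup>+x. indicator A x * emeasure (m x) B \<partial>\<nu>)"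
  by (simp add: L_m_def nn_integral_completion mult.commute)

text \<open>
  Reversibility, applied to the rectangle \<open>A \<times> B\<close>.
\<close>

lemma L_m_commute:
  assumes [measurable]: "A \<in> sets borel" "B \<in> sets borel"
  shows "L_m m \<nu> A B = L_m m \<nu> B A"
proof -
  have AB: "A \<times> B \<in> sets (borel :: ('a \<times> 'a) measure)"
    by (simp add: borel_prod[symmetric])
  have "(\<integral>\<^sup>+x. (\<integral>\<^sup>+y. indicator (A \<times> B) (x, y) \<partial>m x) \<partial>\<nu>) = L_m m \<nu> A B"
    by (simp add: L_m_borel indicator_times nn_integral_cmult)
  moreover have "(\<integral>\<^sup>+y. (\<integral>\<^sup>+x. indicator (A \<times> B) (x, y) \<partial>m y) \<partial>\<nu>) = L_m m \<nu> B A"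
    by (simp add: L_m_borel indicator_times nn_integral_multc mult.commute)
  ultimately show ?thesis
    using reversible[OF AB] by simp
qed

lemma L_m_Un_right:
  assumes [measurable]: "A \<in> sets borel" "B \<in> sets borel" "C \<in> sets borel" and "B \<inter> C = {}"
  shows "L_m m \<nu> A (B \<union> C) = L_m m \<nu> A B + L_m m \<nu> A C"
  using assms(4)
  by (simp add: L_m_borel plus_emeasure[symmetric] distrib_left nn_integral_add)

lemma L_m_Un_left:
  assumes [measurable]: "A \<in> sets borel" "B \<in> sets borel" "C \<in> sets borel" and "A \<inter> B = {}"
  shows "L_m m \<nu> (A \<union> B) C = L_m m \<nu> A C + L_m m \<nu> B C"
  using assms(4) by (simp add: L_m_commute[of _ C] L_m_Un_right)

lemma L_m_mono:
  assumes "A \<in> sets borel" "B \<in> sets borel" "A' \<in> sets borel" "B' \<in> sets borel"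
    and "A \<subseteq> A'" "B \<subseteq> B'"
  shows "L_m m \<nu> A B \<le> L_m m \<nu> A' B'"
  using assms
  by (auto simp: L_m_borel intro!: nn_integral_mono mult_mono emeasure_mono split: split_indicator)

lemma L_m_UNIV:
  assumes [measurable]: "A \<in> sets borel"
  shows "L_m m \<nu> A UNIV = emeasure \<nu> A"
  using prob_space.emeasure_space_1[OF prob_space_m] by (simp add: L_m_borel)

lemma L_m_le_nu:
  assumes "A \<in> sets borel" "B \<in> sets borel"
  shows "L_m m \<nu> A B \<le> emeasure \<nu> A"
  using L_m_mono[OF assms assms(1), of UNIV] assms by (simp add: L_m_UNIV)

section \<open>The coarea formula\<close>

text \<open>
  The level \<open>t\<close> separates \<open>x\<close> from \<open>y\<close> with \<open>x\<close> above when \<open>z y \<le> t < z x\<close>. Since \<open>ennreal\<close> sends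
  negative numbers to 0, the positive part of \<open>z x - z y\<close> is the measure of the set of these levels.
\<close>

lemma coarea_oriented:
  fixes z :: "'a \<Rightarrow> real"
  assumes [measurable]: "z \<in> borel_measurable borel"
  shows "(\<integral>\<^sup>+x. (\<integral>\<^sup>+y. ennreal (z x - z y) \<partial>m x) \<partial>\<nu>) =
      (\<integral>\<^sup>+t. L_m m \<nu> {x. t < z x} {x. z x \<le> t} \<partial>lborel)"
    and "(\<integral>\<^sup>+x. (\<integral>\<^sup>+y. ennreal (z y - z x) \<partial>m x) \<partial>\<nu>) =
      (\<integral>\<^sup>+t. L_m m \<nu> {x. z x \<le> t} {x. t < z x} \<partial>lborel)"
proof -
  interpret sigma_finite_measure \<nu> by (rule sigma_finite_nu)
  interpret pair_sigma_finite \<nu> lborel ..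
  have sf: "sigma_finite_measure (m x)" for x
    using prob_space_m[of x] by (simp add: prob_space_def finite_measure_def)
  have fub: "(\<integral>\<^sup>+x. (\<integral>\<^sup>+t. (\<integral>\<^sup>+y. indicator {a (x, y)..<b (x, y)} t \<partial>m x) \<partial>lborel) \<partial>\<nu>) =
      (\<integral>\<^sup>+t. (\<integral>\<^sup>+x. (\<integral>\<^sup>+y. indicator {a (x, y)..<b (x, y)} t \<partial>m x) \<partial>\<nu>) \<partial>lborel)"
    if [measurable]: "a \<in> borel_measurable (borel \<Otimes>\<^sub>M borel)" "b \<in> borel_measurable (borel \<Otimes>\<^sub>M borel)"
    for a b :: "'a \<times> 'a \<Rightarrow> real"
  proof (rule Fubini'[symmetric])
    have "(\<lambda>(p, y). indicator {a (fst p, y)..<b (fst p, y)} (snd p) :: ennreal)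
        \<in> borel_measurable ((borel \<Otimes>\<^sub>M borel) \<Otimes>\<^sub>M borel)"
      by (simp add: indicator_def)
    from nn_integral_measurable_subprob_algebra2[OF this, of "\<lambda>p. m (fst p)"]
    show "(\<lambda>(x, t). \<integral>\<^sup>+y. indicator {a (x, y)..<b (x, y)} t \<partial>m x)
        \<in> borel_measurable (\<nu> \<Otimes>\<^sub>M lborel)"
      by (simp add: case_prod_beta' cong: measurable_cong_sets)
  qed
  have ind: "(\<integral>\<^sup>+x. (\<integral>\<^sup>+y. indicator {z y..<z x} t \<partial>m x) \<partial>\<nu>) = L_m m \<nu> {x. t < z x} {x. z x \<le> t}"
    "(\<integral>\<^sup>+x. (\<integral>\<^sup>+y. indicator {z x..<z y} t \<partial>m x) \<partial>\<nu>) = L_m m \<nu> {x. z x \<le> t} {x. t < z x}" for t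
  proof -
    have "indicator {z y..<z x} t = (indicator {x. t < z x} x * indicator {x. z x \<le> t} y :: ennreal)"
      for x y by (auto split: split_indicator)
    then show "(\<integral>\<^sup>+x. (\<integral>\<^sup>+y. indicator {z y..<z x} t \<partial>m x) \<partial>\<nu>) = L_m m \<nu> {x. t < z x} {x. z x \<le> t}"
      "(\<integral>\<^sup>+x. (\<integral>\<^sup>+y. indicator {z x..<z y} t \<partial>m x) \<partial>\<nu>) = L_m m \<nu> {x. z x \<le> t} {x. t < z x}"
      by (simp_all add: L_m_borel nn_integral_cmult nn_integral_multc mult.commute)
  qed
  show "(\<integral>\<^sup>+x. (\<integral>\<^sup>+y. ennreal (z x - z y) \<partial>m x) \<partial>\<nu>) =
      (\<integral>\<^sup>+t. L_m m \<nu> {x. t < z x} {x. z x \<le> t} \<partial>lborel)"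
    using nn_integral_layer_cake[OF sf, where g = "\<lambda>_. 1"] fub[of "\<lambda>p. z (snd p)" "\<lambda>p. z (fst p)"]
    by (simp add: ind)
  show "(\<integral>\<^sup>+x. (\<integral>\<^sup>+y. ennreal (z y - z x) \<partial>m x) \<partial>\<nu>) =
      (\<integral>\<^sup>+t. L_m m \<nu> {x. z x \<le> t} {x. t < z x} \<partial>lborel)"
    using nn_integral_layer_cake[OF sf, where g = "\<lambda>_. 1"] fub[of "\<lambda>p. z (fst p)" "\<lambda>p. z (snd p)"]
    by (simp add: ind)
qed

text \<open>
  The coarea formula. By symmetry of \<open>L\<close> the two oriented parts of \<open>\<bar>z y - z x\<bar>\<close> contribute
  equally, which absorbs the factor \<open>1/2\<close>.
\<close>

lemma TV_m_borel:
  assumes [measurable]: "z \<in> borel_measurable borel"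
  shows "TV_m m \<nu> z = (\<integral>\<^sup>+t. P_m m \<nu> {x. t < z x} \<partial>lborel)"
proof -
  have split: "ennreal \<bar>z y - z x\<bar> = ennreal (z x - z y) + ennreal (z y - z x)" for x y
    by (cases "z x \<le> z y") (auto simp: ennreal_neg)
  have m1: "(\<lambda>x. \<integral>\<^sup>+y. ennreal (z x - z y) \<partial>m x) \<in> borel_measurable borel"
    "(\<lambda>x. \<integral>\<^sup>+y. ennreal (z y - z x) \<partial>m x) \<in> borel_measurable borel"
    by (rule nn_integral_measurable_subprob_algebra2[where N=borel]; measurable)+
  have c: "- {x. t < z x} = {x. z x \<le> t}" for t by auto
  have "(\<integral>\<^sup>+x. (\<integral>\<^sup>+y. ennreal \<bar>z y - z x\<bar> \<partial>m x) \<partial>\<nu>) =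
      (\<integral>\<^sup>+x. (\<integral>\<^sup>+y. ennreal (z x - z y) \<partial>m x) \<partial>\<nu>) + (\<integral>\<^sup>+x. (\<integral>\<^sup>+y. ennreal (z y - z x) \<partial>m x) \<partial>\<nu>)"
    using m1 by (simp add: split nn_integral_add)
  also have "\<dots> = 2 * (\<integral>\<^sup>+t. P_m m \<nu> {x. t < z x} \<partial>lborel)"
    by (simp add: coarea_oriented P_m_def c L_m_commute[of "{x. z x \<le> _}"] mult_2)
  finally show ?thesis
    by (simp add: TV_m_def nn_integral_completion mult.assoc[symmetric] ennreal_divide_times
        divide_eq_1_ennreal)
qed

lemma borel_measurable_P_m_superlevel:
  assumes [measurable]: "z \<in> borel_measurable borel"
  shows "(\<lambda>t::real. P_m m \<nu> {x. t < z x}) \<in> borel_measurable borel"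
proof -
  interpret sigma_finite_measure \<nu> by (rule sigma_finite_nu)
  have "(\<lambda>(p, y). indicator {..snd p} (z y) :: ennreal)
      \<in> borel_measurable ((borel \<Otimes>\<^sub>M borel) \<Otimes>\<^sub>M borel)"
    by (simp add: indicator_def)
  from nn_integral_measurable_subprob_algebra2[OF this, of "\<lambda>p. m (fst p)"]
  have int: "(\<lambda>p. \<integral>\<^sup>+y. indicator {..snd p} (z y) \<partial>m (fst p)) \<in> borel_measurable (borel \<Otimes>\<^sub>M borel)"
    by simp
  have em: "(\<integral>\<^sup>+y. indicator {..t} (z y) \<partial>m x) = emeasure (m x) (- {y. t < z y})" for x t
  proof -
    have "(\<integral>\<^sup>+y. indicator {..t} (z y) \<partial>m x) = (\<integral>\<^sup>+y. indicator (- {y. t < z y}) y \<partial>m x)"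
      by (intro nn_integral_cong) (auto split: split_indicator)
    then show ?thesis by simp
  qed
  have [measurable]: "(\<lambda>p. emeasure (m (snd p)) (- {y. fst p < z y}))
      \<in> borel_measurable (borel \<Otimes>\<^sub>M \<nu>)"
    using measurable_compose[of "\<lambda>p. (snd p, fst p)" "borel \<Otimes>\<^sub>M \<nu>" "borel \<Otimes>\<^sub>M borel", OF _ int]
    by (simp add: em)
  have "(\<lambda>(t, x). indicator {t<..} (z x) * emeasure (m x) (- {y. t < z y}))
      \<in> borel_measurable (borel \<Otimes>\<^sub>M \<nu>)"
    by (simp add: case_prod_beta' indicator_def)
  from borel_measurable_nn_integral[OF this] show ?thesis
    by (simp add: P_m_def L_m_borel indicator_def)
qed

section \<open>Calibration inequalities at a level, and the dual bound for the total variation\<close>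

text \<open>
  The boundary flow of \<open>E \<inter> \<Omega>\<close> ends either outside \<open>E\<close>, where it is part of \<open>P(E)\<close>, or in
  \<open>E - \<Omega>\<close>; by symmetry the latter part is at most the flow from \<open>E - \<Omega>\<close> to \<open>\<Omega>\<close>.
\<close>

lemma calibrated_superlevel_inequality:
  assumes [measurable]: "\<Omega> \<in> sets borel" "E \<in> sets borel"
    and calibrated: "\<And>E. E \<in> sets borel \<Longrightarrow> E \<subseteq> \<Omega> \<Longrightarrow> l * emeasure \<nu> E \<le> P_m m \<nu> E"
  shows "l * emeasure \<nu> (E \<inter> \<Omega>) \<le> P_m m \<nu> E + L_m m \<nu> (E - \<Omega>) \<Omega>"
proof -
  have "l * emeasure \<nu> (E \<inter> \<Omega>) \<le> L_m m \<nu> (E \<inter> \<Omega>) (- (E \<inter> \<Omega>))"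
    using calibrated[of "E \<inter> \<Omega>"] by (simp add: P_m_def)
  also have "- (E \<inter> \<Omega>) = - E \<union> (E - \<Omega>)" by auto
  also have "L_m m \<nu> (E \<inter> \<Omega>) (- E \<union> (E - \<Omega>)) =
      L_m m \<nu> (E \<inter> \<Omega>) (- E) + L_m m \<nu> (E \<inter> \<Omega>) (E - \<Omega>)"
    by (rule L_m_Un_right) auto
  also have "L_m m \<nu> (E \<inter> \<Omega>) (E - \<Omega>) = L_m m \<nu> (E - \<Omega>) (E \<inter> \<Omega>)"
    by (rule L_m_commute) auto
  also have "L_m m \<nu> (E \<inter> \<Omega>) (- E) + \<dots> \<le> L_m m \<nu> E (- E) + L_m m \<nu> (E - \<Omega>) \<Omega>"
    by (intro add_mono L_m_mono) auto
  finally show ?thesis by (simp add: P_m_def)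
qed

text \<open>
  Subtracting the calibration inequality for \<open>\<Omega> - F\<close> from \<open>P(\<Omega>) = l \<nu>(\<Omega>)\<close> bounds the flow from
  \<open>F \<inter> \<Omega>\<close> out of \<open>\<Omega>\<close> by \<open>l \<nu>(F \<inter> \<Omega>)\<close> plus the flow from \<open>\<Omega> - F\<close> to \<open>F \<inter> \<Omega>\<close>. The flow from
  \<open>F - \<Omega>\<close> to \<open>\<Omega> - F\<close> is added on both sides; the two flows starting in \<open>\<Omega> - F\<close> are disjoint parts
  of the flow across the boundary of \<open>F\<close>.
\<close>

lemma calibrated_sublevel_inequality:
  assumes [measurable]: "\<Omega> \<in> sets borel" "F \<in> sets borel"
    and calibrated: "\<And>E. E \<in> sets borel \<Longrightarrow> E \<subseteq> \<Omega> \<Longrightarrow> l * emeasure \<nu> E \<le> P_m m \<nu> E"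
    and ratio: "P_m m \<nu> \<Omega> = l * emeasure \<nu> \<Omega>"
    and finite: "emeasure \<nu> \<Omega> < \<infinity>"
  shows "L_m m \<nu> (F - \<Omega>) \<Omega> \<le> P_m m \<nu> (- F) + l * emeasure \<nu> (F \<inter> \<Omega>)"
proof -
  \<comment> \<open>This term occurs on both sides below, and is cancelled.\<close>
  have fin: "L_m m \<nu> (\<Omega> - F) (- \<Omega>) \<noteq> \<infinity>"
    using le_less_trans[OF L_m_le_nu[of "\<Omega> - F" "- \<Omega>"] le_less_trans[OF emeasure_mono finite]]
    by auto
  have "L_m m \<nu> (\<Omega> - F) (- \<Omega>) + L_m m \<nu> (F \<inter> \<Omega>) (- \<Omega>) = L_m m \<nu> ((\<Omega> - F) \<union> (F \<inter> \<Omega>)) (- \<Omega>)"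
    by (rule L_m_Un_left[symmetric]) auto
  also have "(\<Omega> - F) \<union> (F \<inter> \<Omega>) = \<Omega>" by auto
  also have "L_m m \<nu> \<Omega> (- \<Omega>) = l * (emeasure \<nu> (F \<inter> \<Omega>) + emeasure \<nu> (\<Omega> - F))"
    using ratio
    by (subst plus_emeasure)
      (auto simp: P_m_def intro!: arg_cong2[where f="(*)"] arg_cong2[where f=emeasure])
  also have "\<dots> \<le> l * emeasure \<nu> (F \<inter> \<Omega>) + L_m m \<nu> (\<Omega> - F) (- (\<Omega> - F))"
    using calibrated[of "\<Omega> - F"] by (simp add: P_m_def distrib_left)
  also have "- (\<Omega> - F) = - \<Omega> \<union> (F \<inter> \<Omega>)" by auto
  also have "L_m m \<nu> (\<Omega> - F) \<dots> = L_m m \<nu> (\<Omega> - F) (- \<Omega>) + L_m m \<nu> (\<Omega> - F) (F \<inter> \<Omega>)"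
    by (rule L_m_Un_right) auto
  finally have "L_m m \<nu> (\<Omega> - F) (- \<Omega>) + L_m m \<nu> (F \<inter> \<Omega>) (- \<Omega>)
      \<le> L_m m \<nu> (\<Omega> - F) (- \<Omega>) + (l * emeasure \<nu> (F \<inter> \<Omega>) + L_m m \<nu> (\<Omega> - F) (F \<inter> \<Omega>))"
    by (simp add: add_ac)
  then have *: "L_m m \<nu> (F \<inter> \<Omega>) (- \<Omega>) \<le> l * emeasure \<nu> (F \<inter> \<Omega>) + L_m m \<nu> (\<Omega> - F) (F \<inter> \<Omega>)"
    using fin by (simp add: ennreal_add_left_cancel_le)
  have "L_m m \<nu> (F - \<Omega>) \<Omega> = L_m m \<nu> (F - \<Omega>) ((\<Omega> - F) \<union> (F \<inter> \<Omega>))"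
    by (intro arg_cong2[where f="L_m m \<nu>"]) auto
  also have "\<dots> = L_m m \<nu> (F - \<Omega>) (\<Omega> - F) + L_m m \<nu> (F - \<Omega>) (F \<inter> \<Omega>)"
    by (rule L_m_Un_right) auto
  also have "\<dots> = L_m m \<nu> (\<Omega> - F) (F - \<Omega>) + L_m m \<nu> (F \<inter> \<Omega>) (F - \<Omega>)"
    by (intro arg_cong2[where f="(+)"] L_m_commute) auto
  also have "L_m m \<nu> (F \<inter> \<Omega>) (F - \<Omega>) \<le> L_m m \<nu> (F \<inter> \<Omega>) (- \<Omega>)"
    by (rule L_m_mono) auto
  also note *
  also have "L_m m \<nu> (\<Omega> - F) (F - \<Omega>) + (l * emeasure \<nu> (F \<inter> \<Omega>) + L_m m \<nu> (\<Omega> - F) (F \<inter> \<Omega>)) =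
      L_m m \<nu> (\<Omega> - F) ((F - \<Omega>) \<union> (F \<inter> \<Omega>)) + l * emeasure \<nu> (F \<inter> \<Omega>)"
    by (subst L_m_Un_right) (auto simp: add_ac)
  also have "\<dots> \<le> L_m m \<nu> (- F) (- (- F)) + l * emeasure \<nu> (F \<inter> \<Omega>)"
    by (intro add_mono L_m_mono) auto
  finally show ?thesis by (simp add: P_m_def)
qed

text \<open>
  The dual bound \<open>\<integral> (g - k) z \<le> TV(z)\<close>, with its negative terms moved to the other side so
  that every integral makes sense in the extended nonnegative reals, even when some are infinite.
\<close>

lemma calibrated_TV_m_inequality:
  fixes z :: "'a \<Rightarrow> real"
  assumes [measurable]: "\<Omega> \<in> sets borel" "z \<in> borel_measurable borel"
    and calibrated: "\<And>E. E \<in> sets borel \<Longrightarrow> E \<subseteq> \<Omega> \<Longrightarrow> l * emeasure \<nu> E \<le> P_m m \<nu> E"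
    and ratio: "P_m m \<nu> \<Omega> = l * emeasure \<nu> \<Omega>"
    and finite: "emeasure \<nu> \<Omega> < \<infinity>"
  defines "g \<equiv> \<lambda>x. l * indicator \<Omega> x"
    and "k \<equiv> \<lambda>x. indicator (- \<Omega>) x * emeasure (m x) \<Omega>"
  shows "(\<integral>\<^sup>+x. g x * ennreal (z x) + k x * ennreal (- z x) \<partial>\<nu>) \<le>
    TV_m m \<nu> z + (\<integral>\<^sup>+x. g x * ennreal (- z x) + k x * ennreal (z x) \<partial>\<nu>)"
proof -
  interpret sigma_finite_measure \<nu> by (rule sigma_finite_nu)
  have gk [measurable]: "g \<in> borel_measurable borel" "k \<in> borel_measurable borel"
    by (simp_all add: g_def k_def)
  \<comment> \<open>The slice at level \<open>t\<close> of the weighted integral of the positive part of \<open>b - a\<close>.\<close>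
  define I where "I f a b t = (\<integral>\<^sup>+x. f x * indicator {a x..<b x} t \<partial>\<nu>)"
    for f :: "'a \<Rightarrow> ennreal" and a b :: "'a \<Rightarrow> real" and t
  have I_meas [measurable]: "I f a b \<in> borel_measurable borel"
    if [measurable]: "f \<in> borel_measurable borel" "a \<in> borel_measurable borel"
      "b \<in> borel_measurable borel" for f a b
    unfolding I_def by (rule borel_measurable_nn_integral) (simp add: indicator_def)
  have cake: "(\<integral>\<^sup>+x. f x * ennreal (z x) \<partial>\<nu>) = (\<integral>\<^sup>+t. I f (\<lambda>_. 0) z t \<partial>lborel)"
    "(\<integral>\<^sup>+x. f x * ennreal (- z x) \<partial>\<nu>) = (\<integral>\<^sup>+t. I f z (\<lambda>_. 0) t \<partial>lborel)"
    if [measurable]: "f \<in> borel_measurable borel" for f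
    using nn_integral_layer_cake[OF sigma_finite_nu, of "\<lambda>_. 0" z f]
      nn_integral_layer_cake[OF sigma_finite_nu, of z "\<lambda>_. 0" f]
    by (simp_all add: I_def)
  have g_int: "(\<integral>\<^sup>+x. g x * indicator A x \<partial>\<nu>) = l * emeasure \<nu> (A \<inter> \<Omega>)"
    if [measurable]: "A \<in> sets borel" for A
  proof -
    have "(\<integral>\<^sup>+x. g x * indicator A x \<partial>\<nu>) = (\<integral>\<^sup>+x. l * indicator (A \<inter> \<Omega>) x \<partial>\<nu>)"
      by (intro nn_integral_cong) (auto simp: g_def split: split_indicator)
    then show ?thesis by (simp add: nn_integral_cmult_indicator)
  qed
  have k_int: "(\<integral>\<^sup>+x. k x * indicator A x \<partial>\<nu>) = L_m m \<nu> (A - \<Omega>) \<Omega>"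
    if [measurable]: "A \<in> sets borel" for A
    by (auto simp: L_m_borel k_def intro!: nn_integral_cong split: split_indicator)
  have superlevel: "{x. t < z x} \<in> sets borel" and sublevel: "{x. z x \<le> t} \<in> sets borel" for t
    by measurable
  have level: "I g (\<lambda>_. 0) z t + I k z (\<lambda>_. 0) t \<le>
      P_m m \<nu> {x. t < z x} + (I g z (\<lambda>_. 0) t + I k (\<lambda>_. 0) z t)" for t
  proof (cases "0 \<le> t")
    case True
    then have "I f (\<lambda>_. 0) z t = (\<integral>\<^sup>+x. f x * indicator {x. t < z x} x \<partial>\<nu>)" "I f z (\<lambda>_. 0) t = 0" for f
      by (auto simp: I_def intro!: nn_integral_cong split: split_indicator)
    moreover have "l * emeasure \<nu> ({x. t < z x} \<inter> \<Omega>) \<le>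
        P_m m \<nu> {x. t < z x} + L_m m \<nu> ({x. t < z x} - \<Omega>) \<Omega>"
      by (rule calibrated_superlevel_inequality[OF assms(1) superlevel calibrated])
    ultimately show ?thesis
      by (simp add: g_int k_int)
  next
    case False
    then have "I f (\<lambda>_. 0) z t = 0" "I f z (\<lambda>_. 0) t = (\<integral>\<^sup>+x. f x * indicator {x. z x \<le> t} x \<partial>\<nu>)" for f
      by (auto simp: I_def intro!: nn_integral_cong split: split_indicator)
    moreover have "- {x. z x \<le> t} = {x. t < z x}" by auto
    moreover have "L_m m \<nu> ({x. z x \<le> t} - \<Omega>) \<Omega> \<le>
        P_m m \<nu> (- {x. z x \<le> t}) + l * emeasure \<nu> ({x. z x \<le> t} \<inter> \<Omega>)"
      by (rule calibrated_sublevel_inequality[OF assms(1) sublevel calibrated ratio finite])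
    ultimately show ?thesis
      by (simp add: g_int k_int)
  qed
  have "(\<integral>\<^sup>+x. g x * ennreal (z x) + k x * ennreal (- z x) \<partial>\<nu>) =
      (\<integral>\<^sup>+t. I g (\<lambda>_. 0) z t + I k z (\<lambda>_. 0) t \<partial>lborel)"
    by (simp add: nn_integral_add cake)
  also have "\<dots> \<le> (\<integral>\<^sup>+t. P_m m \<nu> {x. t < z x} + (I g z (\<lambda>_. 0) t + I k (\<lambda>_. 0) z t) \<partial>lborel)"
    by (intro nn_integral_mono level)
  also have "\<dots> = TV_m m \<nu> z + (\<integral>\<^sup>+x. g x * ennreal (- z x) + k x * ennreal (z x) \<partial>\<nu>)"
    by (simp add: nn_integral_add cake TV_m_borel borel_measurable_P_m_superlevel)
  finally show ?thesis .
qed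

section \<open>Passage from measurable to Borel sets and functions\<close>

text \<open>
  Invariance gives \<open>\<integral> m\<^sub>x(N) d\<nu> = \<nu>(N) = 0\<close> for a null set \<open>N\<close>. This is what allows passing to Borel
  representatives under the iterated integrals.
\<close>

lemma AE_nu_imp_AE_m:
  assumes "AE x in \<nu>. P x"
  shows "AE x in \<nu>. AE y in m x. P y"
proof -
  obtain N where N: "{x \<in> space \<nu>. \<not> P x} \<subseteq> N" "emeasure \<nu> N = 0" "N \<in> sets \<nu>"
    using assms by (rule AE_E)
  then have "(\<integral>\<^sup>+x. emeasure (m x) N \<partial>\<nu>) = 0"
    using invariant[of N] by simp
  then have "AE x in \<nu>. emeasure (m x) N = 0"
    using N kernel_measurable[of N] by (subst (asm) nn_integral_0_iff_AE) auto
  then show ?thesis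
  proof eventually_elim
    case (elim x)
    show ?case by (rule AE_I[OF _ elim]) (use N in auto)
  qed
qed

lemma TV_m_cong_AE:
  assumes "AE x in \<nu>. u x = v x"
  shows "TV_m m \<nu> u = TV_m m \<nu> v"
proof -
  have "(\<integral>\<^sup>+x. (\<integral>\<^sup>+y. ennreal \<bar>u y - u x\<bar> \<partial>m x) \<partial>\<nu>) =
      (\<integral>\<^sup>+x. (\<integral>\<^sup>+y. ennreal \<bar>v y - v x\<bar> \<partial>m x) \<partial>\<nu>)"
    by (rule nn_integral_cong_AE)
      (use assms AE_nu_imp_AE_m[OF assms] in eventually_elim, auto intro!: nn_integral_cong_AE)
  then show ?thesis by (simp add: TV_m_def nn_integral_completion)
qed

text \<open>
  The set \<open>B\<close> may fail to be measurable for some of the completions of \<open>m x\<close>, where its measure is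
  0 by convention; these \<open>x\<close> form a null set.
\<close>

lemma AE_emeasure_completion_m_cong:
  assumes "AE x in \<nu>. x \<in> B \<longleftrightarrow> x \<in> B'" and [measurable]: "B' \<in> sets borel"
  shows "AE x in \<nu>. emeasure (completion (m x)) B = emeasure (m x) B'"
  using AE_nu_imp_AE_m[OF assms(1)]
proof eventually_elim
  case (elim x)
  have B': "B' \<in> sets (completion (m x))" by auto
  have ae: "AE y in completion (m x). y \<in> B' \<longleftrightarrow> y \<in> B"
    using elim by (auto intro!: AE_completion)
  from complete_measure.in_sets_AE[OF completion.complete_measure_axioms ae B']
  have "B \<in> sets (completion (m x))" by simp
  then have "emeasure (completion (m x)) B = emeasure (completion (m x)) B'"
    using ae B' by (intro emeasure_eq_AE) auto
  then show ?case by simp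
qed

lemma L_m_cong_AE:
  assumes "AE x in \<nu>. x \<in> A \<longleftrightarrow> x \<in> A'" "AE x in \<nu>. x \<in> B \<longleftrightarrow> x \<in> B'"
    and "B' \<in> sets borel"
  shows "L_m m \<nu> A B = L_m m \<nu> A' B'"
  unfolding L_m_def nn_integral_completion
  by (rule nn_integral_cong_AE)
    (use assms(1) AE_emeasure_completion_m_cong[OF assms(2,3)] in eventually_elim,
      use assms(3) in \<open>auto split: split_indicator\<close>)

lemma borel_core:
  assumes "E \<in> sets (completion \<nu>)"
  obtains E' where "E' \<in> sets borel" "E' \<subseteq> E" "AE x in \<nu>. x \<in> E \<longleftrightarrow> x \<in> E'"
    "emeasure (completion \<nu>) E = emeasure \<nu> E'" "P_m m \<nu> E = P_m m \<nu> E'"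
proof
  show E': "main_part \<nu> E \<in> sets borel" using assms by (metis main_part_sets sets_nu)
  show "main_part \<nu> E \<subseteq> E" using main_part_null_part_Un[OF assms] by auto
  show ae: "AE x in \<nu>. x \<in> E \<longleftrightarrow> x \<in> main_part \<nu> E"
    using AE_in_main_part[OF assms] by auto
  show "emeasure (completion \<nu>) E = emeasure \<nu> (main_part \<nu> E)"
    using assms by simp
  show "P_m m \<nu> E = P_m m \<nu> (main_part \<nu> E)"
    unfolding P_m_def by (rule L_m_cong_AE) (use ae E' in auto)
qed

text \<open>
  The superlevel set of \<open>c \<chi>\<^sub>E\<close> at level \<open>t\<close> is \<open>E\<close> for \<open>t\<close> in \<open>[0, c)\<close>. Otherwise it is the whole
  space or empty, and has perimeter 0.
\<close>

lemma TV_m_scaled_indicator: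
  assumes "E \<in> sets (completion \<nu>)" and "0 < c"
  shows "TV_m m \<nu> (\<lambda>x. c * indicator E x) = ennreal c * P_m m \<nu> E"
proof -
  obtain E' where [measurable]: "E' \<in> sets borel" and ae: "AE x in \<nu>. x \<in> E \<longleftrightarrow> x \<in> E'"
    and P: "P_m m \<nu> E = P_m m \<nu> E'"
    using borel_core[OF assms(1)] by metis
  have lev: "P_m m \<nu> {x. t < c * indicator E' x} = P_m m \<nu> E' * indicator {0..<c} t" for t
  proof -
    have "{x. t < c * indicator E' x} = (if t < 0 then UNIV else if t < c then E' else {})"
      using \<open>0 < c\<close> by (auto simp: indicator_def split: if_splits)
    then show ?thesis by (auto simp: P_m_def L_m_borel split: split_indicator)
  qed
  have "TV_m m \<nu> (\<lambda>x. c * indicator E x) = TV_m m \<nu> (\<lambda>x. c * indicator E' x)"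
    by (rule TV_m_cong_AE) (use ae in \<open>auto elim!: eventually_mono split: split_indicator\<close>)
  also have "\<dots> = (\<integral>\<^sup>+t. P_m m \<nu> E' * indicator {0..<c} t \<partial>lborel)"
    by (simp add: TV_m_borel lev)
  also have "\<dots> = ennreal c * P_m m \<nu> E"
    using \<open>0 < c\<close> by (simp add: nn_integral_cmult_indicator P mult.commute)
  finally show ?thesis .
qed

section \<open>Eigenpairs and calibrable sets\<close>

lemma P_m_le_nu:
  assumes "E \<in> sets (completion \<nu>)"
  shows "P_m m \<nu> E \<le> emeasure (completion \<nu>) E"
proof -
  obtain E' where "E' \<in> sets borel" "emeasure (completion \<nu>) E = emeasure \<nu> E'"
    "P_m m \<nu> E = P_m m \<nu> E'"
    using borel_core[OF assms] by metis
  then show ?thesis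
    using L_m_le_nu[of E' "- E'"] by (simp add: P_m_def)
qed

lemma TV_m_normalized_indicator:
  assumes "E \<in> sets (completion \<nu>)"
    and "0 < emeasure (completion \<nu>) E" "emeasure (completion \<nu>) E < \<infinity>"
  shows "TV_m m \<nu> (\<lambda>x. 1 / measure (completion \<nu>) E * indicator E x) = lambda_m m \<nu> E"
proof -
  have em: "emeasure (completion \<nu>) E = ennreal (measure (completion \<nu>) E)"
    using assms(3) by (intro emeasure_eq_ennreal_measure) auto
  with assms(2) have pos: "0 < measure (completion \<nu>) E" by simp
  then have "TV_m m \<nu> (\<lambda>x. 1 / measure (completion \<nu>) E * indicator E x) =
      ennreal (1 / measure (completion \<nu>) E) * P_m m \<nu> E"
    by (intro TV_m_scaled_indicator assms) auto
  also have "\<dots> = lambda_m m \<nu> E"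
    unfolding lambda_m_def em using pos
    by (simp add: divide_ennreal_def inverse_ennreal inverse_eq_divide mult.commute)
  finally show ?thesis .
qed

lemma lambda_m_finite:
  assumes "E \<in> sets (completion \<nu>)"
    and "0 < emeasure (completion \<nu>) E" "emeasure (completion \<nu>) E < \<infinity>"
  shows "lambda_m m \<nu> E < \<infinity>"
  using P_m_le_nu[OF assms(1)] assms(2,3) unfolding lambda_m_def
  by (auto simp: ennreal_divide_eq_top_iff less_top[symmetric] top_unique)

lemma eigenpair_imp_calibrable:
  assumes \<Omega>: "\<Omega> \<in> sets (completion \<nu>)"
    and pos: "0 < emeasure (completion \<nu>) \<Omega>" and fin: "emeasure (completion \<nu>) \<Omega> < \<infinity>"
    and eigen: "m_eigenpair m \<nu> (enn2real (lambda_m m \<nu> \<Omega>))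
      (\<lambda>x. 1 / measure (completion \<nu>) \<Omega> * indicator \<Omega> x)"
  shows "m_calibrable m \<nu> \<Omega>"
proof -
  define l where "l = enn2real (lambda_m m \<nu> \<Omega>)"
  define u where "u = (\<lambda>E x. 1 / measure (completion \<nu>) E * indicator E x :: real)"
  obtain \<xi> where \<xi>: "\<And>x. \<xi> x \<in> multi_sign (u \<Omega> x)"
    and sub: "(\<lambda>x. l * \<xi> x) \<in> subdiff_F m \<nu> (u \<Omega>)"
    using eigen by (auto simp: m_eigenpair_def Delta1_m_def l_def u_def)
  have meas_pos: "0 < measure (completion \<nu>) E"
    if "0 < emeasure (completion \<nu>) E" "emeasure (completion \<nu>) E < \<infinity>" for E
    using that by (simp add: measure_def enn2real_positive_iff)
  have int_u: "integrable (completion \<nu>) (u E)" "(\<integral>x. u E x \<partial>completion \<nu>) = 1"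
    if "E \<in> sets (completion \<nu>)" "0 < emeasure (completion \<nu>) E"
      "emeasure (completion \<nu>) E < \<infinity>" for E
    using that meas_pos[of E] sets.sets_into_space[OF that(1)] by (auto simp: u_def Int_absorb2)
  have \<xi>_1: "\<xi> x = 1" if "x \<in> \<Omega>" for x
    using \<xi>[of x] that meas_pos[OF pos fin] by (simp add: u_def multi_sign_def)
  have le: "lambda_m m \<nu> \<Omega> \<le> lambda_m m \<nu> E"
    if E: "E \<subseteq> \<Omega>" "E \<in> sets (completion \<nu>)" "0 < emeasure (completion \<nu>) E" for E
  proof -
    have finE: "emeasure (completion \<nu>) E < \<infinity>"
      using emeasure_mono[OF E(1) \<Omega>] fin by (rule le_less_trans)
    have "u E \<in> L2_fun \<nu>"
      unfolding u_def by (rule scaled_indicator_L2_fun[OF E(2) finE])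
    then have "enn2ereal (TV_m m \<nu> (u E)) \<ge> enn2ereal (TV_m m \<nu> (u \<Omega>)) +
        ereal (\<integral>x. l * \<xi> x * (u E x - u \<Omega> x) \<partial>completion \<nu>)"
      using sub by (simp add: subdiff_F_def)
    \<comment> \<open>The difference vanishes off \<open>\<Omega>\<close>, and \<open>\<xi>\<close> is 1 on \<open>\<Omega>\<close>.\<close>
    also have "(\<lambda>x. l * \<xi> x * (u E x - u \<Omega> x)) = (\<lambda>x. l * (u E x - u \<Omega> x))"
      using E(1) \<xi>_1 by (auto simp: u_def fun_eq_iff split: split_indicator)
    also have "(\<integral>x. l * (u E x - u \<Omega> x) \<partial>completion \<nu>) = 0"
      using int_u[OF E(2,3) finE] int_u[OF \<Omega> pos fin] by simp
    finally show ?thesis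
      using TV_m_normalized_indicator[OF \<Omega> pos fin] TV_m_normalized_indicator[OF E(2,3) finE]
      by (simp add: u_def less_eq_ennreal.rep_eq zero_ereal_def[symmetric])
  qed
  show ?thesis
    unfolding m_calibrable_def
  proof (rule antisym)
    show "lambda_m m \<nu> \<Omega> \<le> (INF E\<in>{E. E \<subseteq> \<Omega> \<and> E \<in> sets (completion \<nu>) \<and>
        0 < emeasure (completion \<nu>) E}. P_m m \<nu> E / emeasure (completion \<nu>) E)"
      using le by (intro INF_greatest) (auto simp: lambda_m_def)
    show "(INF E\<in>{E. E \<subseteq> \<Omega> \<and> E \<in> sets (completion \<nu>) \<and>
        0 < emeasure (completion \<nu>) E}. P_m m \<nu> E / emeasure (completion \<nu>) E) \<le> lambda_m m \<nu> \<Omega>"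
      unfolding lambda_m_def by (rule INF_lower) (use \<Omega> pos in auto)
  qed
qed

lemma calibrable_imp_eigenpair:
  assumes \<Omega>: "\<Omega> \<in> sets (completion \<nu>)"
    and pos: "0 < emeasure (completion \<nu>) \<Omega>" and fin: "emeasure (completion \<nu>) \<Omega> < \<infinity>"
    and calibrable: "m_calibrable m \<nu> \<Omega>"
    and outside: "AE x in completion \<nu>. x \<notin> \<Omega> \<longrightarrow>
      emeasure (completion (m x)) \<Omega> \<le> lambda_m m \<nu> \<Omega>"
  shows "m_eigenpair m \<nu> (enn2real (lambda_m m \<nu> \<Omega>))
    (\<lambda>x. 1 / measure (completion \<nu>) \<Omega> * indicator \<Omega> x)"
proof -
  obtain B where B [measurable]: "B \<in> sets borel" and "B \<subseteq> \<Omega>"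
    and aeB: "AE x in \<nu>. x \<in> \<Omega> \<longleftrightarrow> x \<in> B"
    and emB: "emeasure (completion \<nu>) \<Omega> = emeasure \<nu> B" and PB: "P_m m \<nu> \<Omega> = P_m m \<nu> B"
    using borel_core[OF \<Omega>] by metis
  define \<omega> where "\<omega> = measure (completion \<nu>) \<Omega>"
  define l where "l = enn2real (lambda_m m \<nu> \<Omega>)"
  define q where "q x = measure (m x) B" for x
  define u where "u = (\<lambda>x. 1 / \<omega> * indicator \<Omega> x :: real)"
  have \<omega>: "emeasure (completion \<nu>) \<Omega> = ennreal \<omega>" "0 < \<omega>"
    using pos fin by (auto simp: \<omega>_def measure_def enn2real_positive_iff)
  have l: "lambda_m m \<nu> \<Omega> = ennreal l" "0 \<le> l"
    using lambda_m_finite[OF \<Omega> pos fin] by (auto simp: l_def)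
  have q: "emeasure (m x) B = ennreal (q x)" "0 \<le> q x" "q x \<le> 1" for x
  proof -
    interpret prob_space "m x" by (rule prob_space_m)
    show "emeasure (m x) B = ennreal (q x)" "0 \<le> q x" "q x \<le> 1"
      by (simp_all add: q_def emeasure_eq_measure)
  qed
  have q_meas [measurable]: "q \<in> borel_measurable borel"
    unfolding q_def measure_def by simp
  have int_q: "integrable (completion \<nu>) q"
  proof -
    have "(\<integral>\<^sup>+x. ennreal (q x) \<partial>\<nu>) < \<infinity>"
      using invariant[OF B] fin by (simp add: q(1) emB)
    then have "integrable \<nu> q"
      using q(2) by (intro integrableI_nonneg) auto
    then show ?thesis by (subst integrable_completion) auto
  qed

  \<comment> \<open>The last branch concerns a null set only, but \<open>\<xi>\<close> must be a sign selection at every point.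
    If \<open>l = 0\<close>, then \<open>q x = 0\<close> in the middle branch, and \<open>q x / l = 0\<close> is a consistent value.\<close>
  define \<xi> where "\<xi> x = (if x \<in> \<Omega> then 1 else if q x \<le> l then - (q x / l) else 0)" for x
  have \<xi>_sign: "\<xi> x \<in> multi_sign (u x)" for x
  proof (cases "x \<in> \<Omega>")
    case False
    have "0 \<le> q x / l" "q x \<le> l \<Longrightarrow> q x / l \<le> 1"
      using q(2)[of x] l(2) by (auto simp: divide_le_eq_1)
    then show ?thesis
      using False by (auto simp: \<xi>_def u_def multi_sign_def)
  qed (use \<omega>(2) in \<open>simp add: \<xi>_def u_def multi_sign_def\<close>)
  have [measurable]: "\<Omega> \<in> sets (completion \<nu>)" "q \<in> borel_measurable (completion \<nu>)"
    using \<Omega> by (auto intro: measurable_completion)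
  have \<xi>_meas [measurable]: "\<xi> \<in> borel_measurable (completion \<nu>)"
    unfolding \<xi>_def[abs_def] by measurable
  have l\<xi>_out: "l * \<xi> x = (if q x \<le> l then - q x else 0)" if "x \<notin> \<Omega>" for x
    using that q(2)[of x] l(2) by (auto simp: \<xi>_def)
  have l\<xi>_L2: "(\<lambda>x. l * \<xi> x) \<in> L2_fun \<nu>"
  proof -
    have "integrable (completion \<nu>) (\<lambda>x. (l * \<xi> x)\<^sup>2)"
    proof (rule Bochner_Integration.integrable_bound)
      show "integrable (completion \<nu>) (\<lambda>x. l\<^sup>2 * indicator \<Omega> x + q x)"
        using int_q \<Omega> fin by simp
      \<comment> \<open>Square integrability off \<open>\<Omega>\<close> follows from \<open>q\<^sup>2 \<le> q\<close> and \<open>\<integral> q = \<nu>(\<Omega>)\<close>, by invariance.\<close>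
      have "norm ((l * \<xi> x)\<^sup>2) \<le> norm (l\<^sup>2 * indicator \<Omega> x + q x)" for x
      proof (cases "x \<in> \<Omega>")
        case True
        then show ?thesis using q(2)[of x] by (simp add: \<xi>_def)
      next
        case False
        have "(q x)\<^sup>2 \<le> q x"
          using q(2,3)[of x] by (simp add: power2_eq_square mult_left_le)
        then show ?thesis using q(2)[of x] False by (simp add: l\<xi>_out)
      qed
      then show "AE x in completion \<nu>. norm ((l * \<xi> x)\<^sup>2) \<le> norm (l\<^sup>2 * indicator \<Omega> x + q x)"
        by simp
    qed measurable
    then show ?thesis by (simp add: L2_fun_def)
  qed
  have ae_l\<xi>: "AE x in \<nu>. l * \<xi> x = (if x \<in> B then l else - q x)"
    using outside[unfolded AE_completion_iff] aeB AE_emeasure_completion_m_cong[OF aeB B]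
  proof eventually_elim
    case (elim x)
    show ?case
    proof (cases "x \<in> \<Omega>")
      case True
      then show ?thesis using elim(2) by (simp add: \<xi>_def)
    next
      case False
      then have "ennreal (q x) \<le> ennreal l" using elim by (simp add: q(1) l(1))
      then have "q x \<le> l" using l(2) by (simp add: ennreal_le_iff)
      then show ?thesis using False elim(2) by (simp add: l\<xi>_out)
    qed
  qed

  have ratio: "P_m m \<nu> B = ennreal l * emeasure \<nu> B"
    using pos fin unfolding l(1)[symmetric] lambda_m_def PB emB
    by (simp add: ennreal_divide_times mult_divide_eq_ennreal)
  have calibrated: "ennreal l * emeasure \<nu> E \<le> P_m m \<nu> E"
    if "E \<in> sets borel" "E \<subseteq> B" for E
  proof (cases "emeasure \<nu> E = 0")
    case False
    have finE: "emeasure \<nu> E \<noteq> \<infinity>"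
      using emeasure_mono[OF that(2), of \<nu>] fin by (auto simp: emB top_unique)
    have emE: "emeasure (completion \<nu>) E = emeasure \<nu> E" using that by simp
    have "ennreal l \<le> P_m m \<nu> E / emeasure \<nu> E"
      using calibrable that False \<open>B \<subseteq> \<Omega>\<close> unfolding m_calibrable_def l(1)
      by (auto simp: emE zero_less_iff_neq_zero intro!: INF_lower2[of E])
    then have "ennreal l * emeasure \<nu> E \<le> P_m m \<nu> E / emeasure \<nu> E * emeasure \<nu> E"
      by (rule mult_right_mono) simp
    also have "\<dots> = P_m m \<nu> E"
      using False finE by (simp add: ennreal_divide_times less_top)
    finally show ?thesis .
  qed simp

  have u_L2: "u \<in> L2_fun \<nu>"
    unfolding u_def by (rule scaled_indicator_L2_fun[OF \<Omega> fin])
  have TV_u: "TV_m m \<nu> u = ennreal l"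
    using TV_m_normalized_indicator[OF \<Omega> pos fin] by (simp add: u_def \<omega>_def l(1))
  have int_l\<xi>_u: "(\<integral>x. l * \<xi> x * u x \<partial>completion \<nu>) = l"
  proof -
    have "(\<lambda>x. l * \<xi> x * u x) = (\<lambda>x. l / \<omega> * indicator \<Omega> x)"
      by (auto simp: u_def \<xi>_def fun_eq_iff split: split_indicator)
    then show ?thesis
      using \<omega>(2) sets.sets_into_space[OF \<Omega>] by (simp add: \<omega>_def[symmetric] Int_absorb2)
  qed
  have dual: "ereal (\<integral>x. l * \<xi> x * z x \<partial>completion \<nu>) \<le> enn2ereal (TV_m m \<nu> z)"
    if z: "z \<in> L2_fun \<nu>" for z
  proof (rule ereal_integral_le)
    show "integrable (completion \<nu>) (\<lambda>x. l * \<xi> x * z x)"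
      by (rule integrable_mult_L2_fun[OF l\<xi>_L2 z])
    obtain z' where [measurable]: "z' \<in> borel_measurable borel" and aez: "AE x in \<nu>. z x = z' x"
      using completion_ex_borel_measurable_real[of z \<nu>] z
      by (auto simp: L2_fun_def measurable_cong_sets[OF sets_nu refl])
    have "(\<integral>\<^sup>+x. ennreal (l * \<xi> x * z x) \<partial>\<nu>) =
        (\<integral>\<^sup>+x. ennreal l * indicator B x * ennreal (z' x) +
          indicator (- B) x * emeasure (m x) B * ennreal (- z' x) \<partial>\<nu>)"
      by (rule nn_integral_cong_AE, use aez ae_l\<xi> in eventually_elim)
        (use l(2) q(2) in \<open>auto simp: q(1) ennreal_mult'[symmetric] split: split_indicator\<close>)
    also have "\<dots> \<le> TV_m m \<nu> z' + (\<integral>\<^sup>+x. ennreal l * indicator B x * ennreal (- z' x) +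
          indicator (- B) x * emeasure (m x) B * ennreal (z' x) \<partial>\<nu>)"
      by (rule calibrated_TV_m_inequality[OF B _ calibrated ratio])
        (use fin in \<open>simp_all add: emB\<close>)
    also have "(\<integral>\<^sup>+x. ennreal l * indicator B x * ennreal (- z' x) +
          indicator (- B) x * emeasure (m x) B * ennreal (z' x) \<partial>\<nu>) =
        (\<integral>\<^sup>+x. ennreal (- (l * \<xi> x * z x)) \<partial>\<nu>)"
      by (rule nn_integral_cong_AE, use aez ae_l\<xi> in eventually_elim)
        (use l(2) q(2) in \<open>auto simp: q(1) ennreal_mult'[symmetric] split: split_indicator\<close>)
    also have "TV_m m \<nu> z' = TV_m m \<nu> z"
      by (rule TV_m_cong_AE) (use aez in auto)
    finally show "(\<integral>\<^sup>+x. ennreal (l * \<xi> x * z x) \<partial>completion \<nu>) \<le>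
        TV_m m \<nu> z + (\<integral>\<^sup>+x. ennreal (- (l * \<xi> x * z x)) \<partial>completion \<nu>)"
      by (simp add: nn_integral_completion)
  qed
  have "(\<lambda>x. l * \<xi> x) \<in> subdiff_F m \<nu> u"
    unfolding subdiff_F_def
  proof (intro CollectI conjI ballI)
    fix z assume z: "z \<in> L2_fun \<nu>"
    have "(\<integral>x. l * \<xi> x * (z x - u x) \<partial>completion \<nu>) = (\<integral>x. l * \<xi> x * z x \<partial>completion \<nu>) - l"
      using integrable_mult_L2_fun[OF l\<xi>_L2 z] integrable_mult_L2_fun[OF l\<xi>_L2 u_L2]
      by (simp add: right_diff_distrib int_l\<xi>_u)
    then show "enn2ereal (TV_m m \<nu> u) + ereal (\<integral>x. l * \<xi> x * (z x - u x) \<partial>completion \<nu>)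
        \<le> enn2ereal (TV_m m \<nu> z)"
      using dual[OF z] l(2) by (simp add: TV_u)
  qed (use u_L2 l\<xi>_L2 TV_u in auto)
  moreover have "(\<integral>\<^sup>+x. ennreal \<bar>u x\<bar> \<partial>completion \<nu>) = 1"
  proof -
    have "(\<integral>\<^sup>+x. ennreal \<bar>u x\<bar> \<partial>completion \<nu>) = (\<integral>\<^sup>+x. ennreal (1 / \<omega>) * indicator \<Omega> x \<partial>completion \<nu>)"
      using \<omega>(2) by (intro nn_integral_cong) (auto simp: u_def split: split_indicator)
    also have "\<dots> = 1"
      using \<omega> \<Omega> by (simp add: nn_integral_cmult_indicator ennreal_mult'[symmetric])
    finally show ?thesis .
  qed
  ultimately show ?thesis
    using u_L2 \<xi>_sign
    unfolding m_eigenpair_def Delta1_m_def l_def[symmetric] u_def[unfolded \<omega>_def, symmetric]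
    by auto
qed

end

theorem theorem6p5:
  fixes m :: "'a::polish_space \<Rightarrow> 'a measure" and \<nu> :: "'a measure" and \<Omega> :: "'a set"
  assumes "reversible_metric_random_walk m \<nu>"
    and "\<Omega> \<in> sets (completion \<nu>)"
    and "0 < emeasure (completion \<nu>) \<Omega>"
    and "emeasure (completion \<nu>) \<Omega> < emeasure (completion \<nu>) UNIV"
  shows "(m_eigenpair m \<nu> (enn2real (lambda_m m \<nu> \<Omega>))
             (\<lambda>x. 1 / measure (completion \<nu>) \<Omega> * indicator \<Omega> x)
           \<longrightarrow> m_calibrable m \<nu> \<Omega>) \<and>
         (m_calibrable m \<nu> \<Omega> \<and>
           (AE x in completion \<nu>. x \<notin> \<Omega> \<longrightarrow>
              emeasure (completion (m x)) \<Omega> \<le> lambda_m m \<nu> \<Omega>)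
           \<longrightarrow> m_eigenpair m \<nu> (enn2real (lambda_m m \<nu> \<Omega>))
             (\<lambda>x. 1 / measure (completion \<nu>) \<Omega> * indicator \<Omega> x))"
proof -
  interpret reversible_metric_random_walk m \<nu> by fact
  have "emeasure (completion \<nu>) \<Omega> < \<infinity>"
    using assms(4) by (rule less_le_trans) simp
  then show ?thesis
    using assms(2,3) eigenpair_imp_calibrable calibrable_imp_eigenpair by blast
qed

end
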